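(* $\mathcal{M}_0^{UI}\subsetneq \mathcal{M}_0$; that is, every $\mu\in\mathcal{M}_0^{UI}$ belongs to $\mathcal{M}_0$, and there exists $\mu\in\mathcal{M}_0$ with $\mu\notin\mathcal{M}_0^{UI}$.
   Context: $(X_n)_{n\ge 0}$ is the simple symmetric random walk on $\mathbb{Z}$: $X_0=0$ and $X_n=\sum_{k=1}^n\xi_k$ with $(\xi_k)$ i.i.d., $\mathbb{P}(\xi_k=1)=\mathbb{P}(\xi_k=-1)=\frac12$. All stopping times are with respect to the natural filtration of $(X_n)$ (no external randomisation is allowed). $\mathcal{M}_0$ is the set of all centered probability measures on $\mathbb{Z}$, i.e. those with $\sum_n |n|\mu(\{n\})<\infty$ and $\sum_n n\,\mu(\{n\})=0$. $\mathcal{M}_0^{UI}$ is the set of probability measures $\mu$ on $\mathbb{Z}$ for which there exists an (a.s. finite) stopping time $\tau$ in the natural filtration of $X$ such that $X_\tau\sim\mu$ and $(X_{n\wedge\tau}:n\ge 0)$ is a uniformly integrable martingale. *)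

theory Defs
  imports "HOL-Probability.Probability"
begin

text \<open>The space \<open>M\<close> carrying the steps is arbitrary. It may be richer than the walk, but
  stopping times below are taken with respect to the filtration generated by the walk, so no
  external randomisation is available. Only the steps \<open>\<xi> k\<close> with \<open>k \<ge> 1\<close> are used.\<close>

definition simple_symmetric_steps :: "'a measure \<Rightarrow> (nat \<Rightarrow> 'a \<Rightarrow> int) \<Rightarrow> bool" where
  "simple_symmetric_steps M \<xi> \<longleftrightarrow>
     prob_space M \<and>
     prob_space.indep_vars M (\<lambda>_. count_space UNIV) \<xi> {1..} \<and>
     (\<forall>k\<ge>1. measure M {\<omega> \<in> space M. \<xi> k \<omega> = 1} = 1/2 \<and>
            measure M {\<omega> \<in> space M. \<xi> k \<omega> = -1} = 1/2)"

definition walk :: "(nat \<Rightarrow> 'a \<Rightarrow> int) \<Rightarrow> nat \<Rightarrow> 'a \<Rightarrow> int" where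
  "walk \<xi> n \<omega> = (\<Sum>k=1..n. \<xi> k \<omega>)"

text \<open>Times range over \<^typ>\<open>enat\<close> so that a stopping time may be infinite on a null set;
  at \<open>t = \<infinity>\<close> this is the \<open>\<sigma>\<close>-algebra generated by the whole process.\<close>

definition natural_filtration :: "'a measure \<Rightarrow> (nat \<Rightarrow> 'a \<Rightarrow> int) \<Rightarrow> enat \<Rightarrow> 'a measure" where
  "natural_filtration M X t =
     sigma (space M) {X k -` A \<inter> space M | k A. enat k \<le> t}"

definition stopped_process :: "(nat \<Rightarrow> 'a \<Rightarrow> int) \<Rightarrow> ('a \<Rightarrow> enat) \<Rightarrow> nat \<Rightarrow> 'a \<Rightarrow> int" where
  "stopped_process X \<tau> n \<omega> = X (the_enat (min (enat n) (\<tau> \<omega>))) \<omega>"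

text \<open>The value on \<open>{\<tau> = \<infinity>}\<close> is an arbitrary convention; below, that event is null.\<close>

definition stopped_value :: "(nat \<Rightarrow> 'a \<Rightarrow> int) \<Rightarrow> ('a \<Rightarrow> enat) \<Rightarrow> 'a \<Rightarrow> int" where
  "stopped_value X \<tau> \<omega> = (case \<tau> \<omega> of enat n \<Rightarrow> X n \<omega> | \<infinity> \<Rightarrow> 0)"

definition martingale ::
  "'a measure \<Rightarrow> (nat \<Rightarrow> 'a measure) \<Rightarrow> (nat \<Rightarrow> 'a \<Rightarrow> real) \<Rightarrow> bool" where
  "martingale M F Y \<longleftrightarrow>
     filtration (space M) F \<and>
     (\<forall>n. subalgebra M (F n)) \<and>
     (\<forall>n. Y n \<in> borel_measurable (F n)) \<and>
     (\<forall>n. integrable M (Y n)) \<and>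
     (\<forall>m n. m \<le> n \<longrightarrow> (AE \<omega> in M. real_cond_exp M (F m) (Y n) \<omega> = Y m \<omega>))"

definition uniformly_integrable :: "'a measure \<Rightarrow> (nat \<Rightarrow> 'a \<Rightarrow> real) \<Rightarrow> bool" where
  "uniformly_integrable M Y \<longleftrightarrow>
     (\<forall>n. integrable M (Y n)) \<and>
     (\<forall>\<epsilon>>0. \<exists>K. \<forall>n. (LINT \<omega>|M. \<bar>Y n \<omega>\<bar> * indicator {\<omega>. \<bar>Y n \<omega>\<bar> > K} \<omega>) \<le> \<epsilon>)"

text \<open>Probability measures on the integers are rendered as \<^typ>\<open>int pmf\<close>; since the integers
  are countable, these are all of them.\<close>

definition centered_measures :: "int pmf set" where
  "centered_measures =
     {\<mu>. (\<lambda>n::int. \<bar>real_of_int n\<bar> * pmf \<mu> n) summable_on UNIV \<and>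
         (\<Sum>\<^sub>\<infinity>n::int. real_of_int n * pmf \<mu> n) = 0}"

definition UI_embeddable_measures :: "'a measure \<Rightarrow> (nat \<Rightarrow> 'a \<Rightarrow> int) \<Rightarrow> int pmf set" where
  "UI_embeddable_measures M X =
     {\<mu>. \<exists>\<tau>::'a \<Rightarrow> enat.
        stopping_time (natural_filtration M X) \<tau> \<and>
        (AE \<omega> in M. \<tau> \<omega> < \<infinity>) \<and>
        distr M (count_space UNIV) (stopped_value X \<tau>) = measure_pmf \<mu> \<and>
        martingale M (\<lambda>n. natural_filtration M X (enat n))
          (\<lambda>n \<omega>. real_of_int (stopped_process X \<tau> n \<omega>)) \<and>
        uniformly_integrable M (\<lambda>n \<omega>. real_of_int (stopped_process X \<tau> n \<omega>))}"

end

theory Submission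
  imports Defs
begin

text \<open>A uniformly integrable martingale converges in \<open>L\<^sup>1\<close>, so the stopped value closes it: its
  integral over an event of time \<open>m\<close> is that of the process at time \<open>m\<close>. Time \<open>0\<close> gives that
  embedded laws are centred. Conversely, let an embedded law live on \<open>{-1, 0, 1}\<close>. The event of
  stopping at time \<open>0\<close> is trivial, and the closed martingale stays in \<open>{-1..1}\<close>, so a walk that
  has started must stop at its first step, at \<open>-1\<close> or \<open>1\<close>. Hence the mass at \<open>0\<close> is \<open>0\<close> or \<open>1\<close>, and
  the uniform law on \<open>{-1, 0, 1}\<close> is not embeddable.\<close>

section \<open>L1 limits of uniformly integrable sequences and martingales\<close>

text \<open>Clamping values to [-K, K] splits \<open>Y n - Z\<close> into three parts: the excess of
  \<open>Y n\<close> is uniformly small by uniform integrability, that of \<open>Z\<close> inherits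
  the bound by Fatou, and the clamped difference vanishes in mean by dominated convergence.\<close>

lemma uniformly_integrable_L1_limit:
  fixes Y :: "nat \<Rightarrow> 'a \<Rightarrow> real"
  assumes M: "prob_space M"
    and UI: "uniformly_integrable M Y"
    and Z[measurable]: "Z \<in> borel_measurable M"
    and lim: "AE x in M. (\<lambda>n. Y n x) \<longlonglongrightarrow> Z x"
  shows "integrable M Z" and "(\<lambda>n. LINT x|M. \<bar>Y n x - Z x\<bar>) \<longlonglongrightarrow> 0"
proof -
  interpret prob_space M by fact
  define c :: "real \<Rightarrow> real \<Rightarrow> real" where "c K y = max (- K) (min K y)" for K y
  have c_cont: "isCont (c K) y" for K y
    unfolding c_def by (intro continuous_intros)
  have c_meas[measurable]: "c K \<in> borel_measurable borel" for K
    unfolding c_def by measurable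
  have c_bound: "\<bar>c K y\<bar> \<le> K" if "K \<ge> 0" for K y
    using that unfolding c_def by auto
  have Yi: "integrable M (Y n)" for n
    using UI by (auto simp: uniformly_integrable_def)
  then have Ym[measurable]: "Y n \<in> borel_measurable M" for n
    by auto
  have cint: "integrable M (\<lambda>x. c K (f x))" if "K \<ge> 0" "f \<in> borel_measurable M" for K f
    using that c_bound by (intro integrable_const_bound[where B = K]) auto
  \<comment> \<open>One level serves all \<open>Y n\<close> and the limit. The excess of
    \<open>Z\<close> is bounded as a nonnegative integral because \<open>Z\<close> is not yet known
    to be integrable.\<close>
  have key: "\<exists>K\<ge>0. (\<forall>n. (LINT x|M. \<bar>Y n x - c K (Y n x)\<bar>) \<le> e) \<and>
      (\<integral>\<^sup>+x. ennreal \<bar>Z x - c K (Z x)\<bar> \<partial>M) \<le> ennreal e" if e: "e > 0" for e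
  proof -
    obtain K0 where K0: "\<And>n. (LINT x|M. \<bar>Y n x\<bar> * indicator {x. \<bar>Y n x\<bar> > K0} x) \<le> e"
      using UI[unfolded uniformly_integrable_def, THEN conjunct2, rule_format, OF e] by blast
    \<comment> \<open>A clamp needs a nonnegative level. The excess \<open>y - c K y\<close>
      vanishes unless \<open>\<bar>y\<bar> > K\<close>, and is then at most
      \<open>\<bar>y\<bar>\<close> in absolute value.\<close>
    define K where "K = max K0 0"
    have K: "K \<ge> 0" by (simp add: K_def)
    have bnd: "(LINT x|M. \<bar>Y n x - c K (Y n x)\<bar>) \<le> e" for n
    proof -
      have "(LINT x|M. \<bar>Y n x - c K (Y n x)\<bar>) \<le>
          (LINT x|M. \<bar>Y n x\<bar> * indicator {x. \<bar>Y n x\<bar> > K0} x)"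
      proof (rule integral_mono)
        show "integrable M (\<lambda>x. \<bar>Y n x - c K (Y n x)\<bar>)"
          using Yi cint[OF K Ym] by auto
        show "integrable M (\<lambda>x. \<bar>Y n x\<bar> * indicator {x. \<bar>Y n x\<bar> > K0} x)"
          by (rule Bochner_Integration.integrable_bound[OF Yi[of n]]) (auto split: split_indicator)
        show "\<bar>Y n x - c K (Y n x)\<bar> \<le> \<bar>Y n x\<bar> * indicator {x. \<bar>Y n x\<bar> > K0} x" for x
          by (auto simp: c_def K_def split: split_indicator)
      qed
      with K0[of n] show ?thesis by linarith
    qed
    \<comment> \<open>Continuity of the clamp makes the integrand an almost sure limit, so Fatou's
      lemma carries the uniform bound over to \<open>Z\<close>.\<close>
    have "(\<integral>\<^sup>+x. ennreal \<bar>Z x - c K (Z x)\<bar> \<partial>M) =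
        (\<integral>\<^sup>+x. liminf (\<lambda>n. ennreal \<bar>Y n x - c K (Y n x)\<bar>) \<partial>M)"
    proof (rule nn_integral_cong_AE, use lim in eventually_elim)
      fix x assume "(\<lambda>n. Y n x) \<longlonglongrightarrow> Z x"
      then have "(\<lambda>n. ennreal \<bar>Y n x - c K (Y n x)\<bar>) \<longlonglongrightarrow> ennreal \<bar>Z x - c K (Z x)\<bar>"
        by (intro tendsto_intros isCont_tendsto_compose[OF c_cont])
      then show "ennreal \<bar>Z x - c K (Z x)\<bar> = liminf (\<lambda>n. ennreal \<bar>Y n x - c K (Y n x)\<bar>)"
        by (intro lim_imp_Liminf[symmetric]) auto
    qed
    also have "\<dots> \<le> liminf (\<lambda>n. \<integral>\<^sup>+x. ennreal \<bar>Y n x - c K (Y n x)\<bar> \<partial>M)"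
      by (rule nn_integral_liminf) measurable
    also have "\<dots> \<le> ennreal e"
    proof -
      have "(\<integral>\<^sup>+x. ennreal \<bar>Y n x - c K (Y n x)\<bar> \<partial>M) \<le> ennreal e" for n
        using bnd[of n] Yi[of n] cint[OF K Ym[of n]]
        by (subst nn_integral_eq_integral) (auto intro!: ennreal_leI)
      then have "liminf (\<lambda>n. \<integral>\<^sup>+x. ennreal \<bar>Y n x - c K (Y n x)\<bar> \<partial>M) \<le> liminf (\<lambda>n::nat. ennreal e)"
        by (intro Liminf_mono) auto
      then show ?thesis by (simp add: Liminf_const)
    qed
    finally show ?thesis using bnd K by blast
  qed
  have tail_int: "integrable M (\<lambda>x. Z x - c K (Z x))"
    if "(\<integral>\<^sup>+x. ennreal \<bar>Z x - c K (Z x)\<bar> \<partial>M) \<le> ennreal e" for K e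
    using that by (intro integrableI_bounded) (auto intro: le_less_trans)
  show Zi: "integrable M Z"
  proof -
    obtain K where K: "K \<ge> 0" "(\<integral>\<^sup>+x. ennreal \<bar>Z x - c K (Z x)\<bar> \<partial>M) \<le> ennreal 1"
      using key[of 1] by auto
    have "integrable M (\<lambda>x. (Z x - c K (Z x)) + c K (Z x))"
      using tail_int[OF K(2)] cint[OF K(1) Z] by (rule Bochner_Integration.integrable_add)
    then show ?thesis by simp
  qed
  show "(\<lambda>n. LINT x|M. \<bar>Y n x - Z x\<bar>) \<longlonglongrightarrow> 0"
  proof (rule order_tendstoI)
    fix a :: real assume "a < 0"
    then show "\<forall>\<^sub>F n in sequentially. a < (LINT x|M. \<bar>Y n x - Z x\<bar>)"
      by (intro always_eventually allI less_le_trans[OF _ integral_nonneg_AE]) auto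
  next
    fix a :: real assume a: "0 < a"
    obtain K where K: "K \<ge> 0" "\<And>n. (LINT x|M. \<bar>Y n x - c K (Y n x)\<bar>) \<le> a / 3"
      "(\<integral>\<^sup>+x. ennreal \<bar>Z x - c K (Z x)\<bar> \<partial>M) \<le> ennreal (a / 3)"
      using key[of "a/3"] a by auto
    have Zt: "(LINT x|M. \<bar>Z x - c K (Z x)\<bar>) \<le> a / 3"
      using K(3) tail_int[OF K(3)] a by (subst (asm) nn_integral_eq_integral) auto
    have "(\<lambda>n. LINT x|M. \<bar>c K (Y n x) - c K (Z x)\<bar>) \<longlonglongrightarrow> (LINT x|M. 0)"
    proof (rule integral_dominated_convergence[where w = "\<lambda>_. 2 * K"])
      show "AE x in M. (\<lambda>n. \<bar>c K (Y n x) - c K (Z x)\<bar>) \<longlonglongrightarrow> 0"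
        using lim
      proof eventually_elim
        fix x assume "(\<lambda>n. Y n x) \<longlonglongrightarrow> Z x"
        then have "(\<lambda>n. \<bar>c K (Y n x) - c K (Z x)\<bar>) \<longlonglongrightarrow> \<bar>c K (Z x) - c K (Z x)\<bar>"
          by (intro tendsto_intros isCont_tendsto_compose[OF c_cont])
        then show "(\<lambda>n. \<bar>c K (Y n x) - c K (Z x)\<bar>) \<longlonglongrightarrow> 0" by simp
      qed
      show "AE x in M. norm \<bar>c K (Y n x) - c K (Z x)\<bar> \<le> 2 * K" for n
      proof (rule AE_I2)
        fix x
        show "norm \<bar>c K (Y n x) - c K (Z x)\<bar> \<le> 2 * K"
          using c_bound[OF K(1), of "Y n x"] c_bound[OF K(1), of "Z x"] by simp
      qed
    qed auto
    then have "\<forall>\<^sub>F n in sequentially. (LINT x|M. \<bar>c K (Y n x) - c K (Z x)\<bar>) < a / 3"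
      using a by (intro order_tendstoD(2)) auto
    then show "\<forall>\<^sub>F n in sequentially. (LINT x|M. \<bar>Y n x - Z x\<bar>) < a"
    proof eventually_elim
      fix n assume n: "(LINT x|M. \<bar>c K (Y n x) - c K (Z x)\<bar>) < a / 3"
      have i: "integrable M (\<lambda>x. \<bar>Y n x - c K (Y n x)\<bar>)"
        "integrable M (\<lambda>x. \<bar>c K (Y n x) - c K (Z x)\<bar>)"
        "integrable M (\<lambda>x. \<bar>Z x - c K (Z x)\<bar>)"
        using Yi[of n] Zi cint[OF K(1) Z] cint[OF K(1) Ym] by auto
      have "(LINT x|M. \<bar>Y n x - Z x\<bar>) \<le>
          (LINT x|M. \<bar>Y n x - c K (Y n x)\<bar> + \<bar>c K (Y n x) - c K (Z x)\<bar> + \<bar>Z x - c K (Z x)\<bar>)"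
        using i Yi[of n] Zi
        by (intro integral_mono Bochner_Integration.integrable_add) auto
      also have "\<dots> = (LINT x|M. \<bar>Y n x - c K (Y n x)\<bar>) + (LINT x|M. \<bar>c K (Y n x) - c K (Z x)\<bar>)
          + (LINT x|M. \<bar>Z x - c K (Z x)\<bar>)"
        using i by simp
      also have "\<dots> < a" using n K(2)[of n] Zt by linarith
      finally show "(LINT x|M. \<bar>Y n x - Z x\<bar>) < a" .
    qed
  qed
qed

text \<open>From time \<open>m\<close> on, the integrals over \<open>A\<close> stay constant by the
  defining property of conditional expectation; L1 convergence identifies this constant with the
  integral of the limit.\<close>

lemma martingale_set_integral_limit:
  fixes Y :: "nat \<Rightarrow> 'a \<Rightarrow> real"
  assumes M: "prob_space M"
    and mart: "martingale M F Y"
    and UI: "uniformly_integrable M Y"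
    and Z: "Z \<in> borel_measurable M"
    and lim: "AE x in M. (\<lambda>n. Y n x) \<longlonglongrightarrow> Z x"
    and A: "A \<in> sets (F m)"
  shows "(LINT x:A|M. Y m x) = (LINT x:A|M. Z x)"
proof -
  interpret prob_space M by fact
  note L1 = uniformly_integrable_L1_limit[OF M UI Z lim]
  have sub: "subalgebra M (F m)" and Yi: "integrable M (Y n)" for n
    using mart by (auto simp: martingale_def)
  have AM[measurable]: "A \<in> sets M"
    using A sub by (auto simp: subalgebra_def)
  interpret finite_measure_subalgebra M "F m"
    by unfold_locales (rule sub)
  have const: "(LINT x:A|M. Y n x) = (LINT x:A|M. Y m x)" if "m \<le> n" for n
  proof -
    have "AE x in M. real_cond_exp M (F m) (Y n) x = Y m x"
      using mart that by (auto simp: martingale_def)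
    then have "AE x\<in>A in M. real_cond_exp M (F m) (Y n) x = Y m x"
      by eventually_elim simp
    then have "(LINT x:A|M. real_cond_exp M (F m) (Y n) x) = (LINT x:A|M. Y m x)"
      using borel_measurable_integrable[OF Yi[of m]] AM
      by (intro set_lebesgue_integral_cong_AE) measurable
    then show ?thesis
      using real_cond_exp_intA[OF Yi A, of n] by simp
  qed
  have si: "set_integrable M A (Y n)" "set_integrable M A Z" for n
    using integrable_mult_indicator[OF AM Yi] integrable_mult_indicator[OF AM L1(1)]
    unfolding set_integrable_def by blast+
  have "(\<lambda>n. LINT x:A|M. Y n x) \<longlonglongrightarrow> (LINT x:A|M. Z x)"
  proof (rule LIM_zero_cancel, rule Lim_null_comparison[OF _ L1(2)], intro always_eventually allI)
    fix n
    have "norm ((LINT x:A|M. Y n x) - (LINT x:A|M. Z x)) = norm (LINT x:A|M. Y n x - Z x)"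
      by (simp only: set_integral_diff(2)[OF si])
    also have "\<dots> \<le> (LINT x|M. norm (indicator A x *\<^sub>R (Y n x - Z x)))"
      unfolding set_lebesgue_integral_def by (rule integral_norm_bound)
    also have "\<dots> \<le> (LINT x|M. \<bar>Y n x - Z x\<bar>)"
      using Yi L1(1) AM
      by (intro integral_mono integrable_norm integrable_mult_indicator) (auto split: split_indicator)
    finally show "norm ((LINT x:A|M. Y n x) - (LINT x:A|M. Z x)) \<le> (LINT x|M. \<bar>Y n x - Z x\<bar>)" .
  qed
  moreover have "(\<lambda>n. LINT x:A|M. Y n x) \<longlonglongrightarrow> (LINT x:A|M. Y m x)"
    by (intro tendsto_eventually eventually_sequentiallyI[of m] const)
  ultimately show ?thesis using LIMSEQ_unique by blast
qed

section \<open>Natural filtration, stopping times and stopped values\<close>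

lemma space_natural_filtration [simp]: "space (natural_filtration M X t) = space M"
  unfolding natural_filtration_def by (rule space_measure_of) auto

lemma sets_natural_filtration:
  "sets (natural_filtration M X t) = sigma_sets (space M) {X k -` A \<inter> space M | k A. enat k \<le> t}"
  unfolding natural_filtration_def by (rule sets_measure_of) auto

lemma vimage_in_natural_filtration:
  "enat k \<le> t \<Longrightarrow> X k -` A \<inter> space M \<in> sets (natural_filtration M X t)"
  unfolding sets_natural_filtration by (rule sigma_sets.Basic) auto

text \<open>Events of the natural filtration at time \<open>t\<close> cannot separate paths that agree up to \<open>t\<close>;
  this is where external randomisation is excluded.\<close>

lemma natural_filtration_determined:
  assumes "A \<in> sets (natural_filtration M X t)"
    and "\<omega> \<in> space M" "\<omega>' \<in> space M" "\<And>k. enat k \<le> t \<Longrightarrow> X k \<omega> = X k \<omega>'"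
  shows "\<omega> \<in> A \<longleftrightarrow> \<omega>' \<in> A"
  using assms(1) unfolding sets_natural_filtration
  by (induction rule: sigma_sets.induct) (use assms(2-4) in auto)

text \<open>This holds at every point, not just almost surely, so a single path decides for all
  paths that share its past.\<close>

lemma stopping_time_determined:
  assumes "stopping_time (natural_filtration M X) \<tau>"
    and "\<omega> \<in> space M" "\<omega>' \<in> space M" "\<And>k. enat k \<le> t \<Longrightarrow> X k \<omega> = X k \<omega>'"
  shows "\<tau> \<omega> \<le> t \<longleftrightarrow> \<tau> \<omega>' \<le> t"
proof -
  have "{\<omega> \<in> space M. \<tau> \<omega> \<le> t} \<in> sets (natural_filtration M X t)"
    using stopping_timeD[OF assms(1), of t] by (simp add: pred_def)
  from natural_filtration_determined[OF this assms(2-4)] assms(2,3) show ?thesis by auto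
qed

lemma measurable_stopped_value:
  assumes sub: "\<And>n. subalgebra M (natural_filtration M X (enat n))"
    and \<tau>: "stopping_time (natural_filtration M X) \<tau>"
  shows "stopped_value X \<tau> \<in> measurable M (count_space UNIV)"
proof (rule measurable_count_space_eq2_countable[THEN iffD2], safe)
  fix z :: int
  have X: "X n -` A \<inter> space M \<in> sets M" for n A
    using vimage_in_natural_filtration[of n "enat n" X A M] sub[of n] by (auto simp: subalgebra_def)
  have T: "{\<omega> \<in> space M. \<tau> \<omega> \<le> enat n} \<in> sets M" for n
    using stopping_timeD[OF \<tau>, of "enat n"] sub[of n] by (auto simp: pred_def subalgebra_def)
  \<comment> \<open>The fibre over \<open>z\<close> is cut up by the value of \<open>\<tau>\<close>.
    The set difference isolates stopping exactly at \<open>n\<close> using only events of the form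
    \<open>\<tau> \<le> enat n\<close>.\<close>
  define B where "B n = (X n -` {z} \<inter> space M) \<inter>
      ({\<omega> \<in> space M. \<tau> \<omega> \<le> enat n} - (\<Union>m<n. {\<omega> \<in> space M. \<tau> \<omega> \<le> enat m}))" for n
  \<comment> \<open>Never stopping yields the default value \<open>0\<close>, so it adds only to the
    fibre over \<open>0\<close>.\<close>
  define C where "C = (if z = 0 then space M - (\<Union>n. {\<omega> \<in> space M. \<tau> \<omega> \<le> enat n}) else {})"
  have BC: "B n \<in> sets M" "C \<in> sets M" for n
    unfolding B_def C_def using X T by auto
  have B: "B n = {\<omega> \<in> space M. \<tau> \<omega> = enat n \<and> X n \<omega> = z}" for n
  proof -
    have "(t \<le> enat n \<and> (\<forall>m<n. \<not> t \<le> enat m)) \<longleftrightarrow> t = enat n" for t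
      by (cases t) (auto simp: not_le intro: le_neq_implies_less)
    then show ?thesis unfolding B_def by auto
  qed
  have C: "C = {\<omega> \<in> space M. \<tau> \<omega> = \<infinity> \<and> z = 0}"
  proof -
    have "(\<forall>n. \<not> t \<le> enat n) \<longleftrightarrow> t = \<infinity>" for t by (cases t) auto
    then show ?thesis unfolding C_def by auto
  qed
  have "stopped_value X \<tau> -` {z} \<inter> space M = (\<Union>n. B n) \<union> C"
    unfolding B C stopped_value_def by (auto split: enat.splits)
  with BC show "stopped_value X \<tau> -` {z} \<inter> space M \<in> sets M" by auto
qed auto

lemma stopped_process_tendsto:
  assumes "\<tau> \<omega> < \<infinity>"
  shows "(\<lambda>n. real_of_int (stopped_process X \<tau> n \<omega>)) \<longlonglongrightarrow> real_of_int (stopped_value X \<tau> \<omega>)"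
proof -
  obtain m where m: "\<tau> \<omega> = enat m" using assms by (cases "\<tau> \<omega>") auto
  show ?thesis
    by (intro tendsto_eventually eventually_sequentiallyI[of m])
      (auto simp: stopped_process_def stopped_value_def m min_def)
qed

section \<open>Centred laws as expectations\<close>

lemma centered_measures_iff_expectation:
  "\<mu> \<in> centered_measures \<longleftrightarrow>
     integrable (measure_pmf \<mu>) real_of_int \<and> measure_pmf.expectation \<mu> real_of_int = 0"
proof -
  \<comment> \<open>A pmf is a density over counting measure, so integrability is absolute
    summability in the sense of \<open>Infinite_Set_Sum\<close>, which is then converted to
    \<open>summable_on\<close>.\<close>
  have eq: "integrable (measure_pmf \<mu>) real_of_int \<longleftrightarrow>
      Infinite_Set_Sum.abs_summable_on (\<lambda>n. real_of_int n * pmf \<mu> n) UNIV"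
    unfolding abs_summable_on_def measure_pmf_eq_density
    by (subst integrable_density) (auto simp: mult.commute)
  also have "\<dots> \<longleftrightarrow> (\<lambda>n. norm (real_of_int n * pmf \<mu> n)) summable_on UNIV"
    by (rule abs_summable_equivalent[symmetric])
  also have "(\<lambda>n. norm (real_of_int n * pmf \<mu> n)) = (\<lambda>n. \<bar>real_of_int n\<bar> * pmf \<mu> n)"
    by (simp add: abs_mult)
  finally have *: "integrable (measure_pmf \<mu>) real_of_int \<longleftrightarrow>
      (\<lambda>n. \<bar>real_of_int n\<bar> * pmf \<mu> n) summable_on UNIV" .
  have "measure_pmf.expectation \<mu> real_of_int = (\<Sum>\<^sub>\<infinity>n. real_of_int n * pmf \<mu> n)"
    if "integrable (measure_pmf \<mu>) real_of_int"
    unfolding pmf_expectation_eq_infsetsum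
    using that eq by (subst infsetsum_infsum) (auto simp: mult.commute)
  with * show ?thesis by (auto simp: centered_measures_def)
qed

section \<open>Consequences of an embedding\<close>

locale embedded_walk = prob_space M
  for M :: "'a measure" and \<xi> :: "nat \<Rightarrow> 'a \<Rightarrow> int" and \<tau> :: "'a \<Rightarrow> enat" and \<mu> :: "int pmf" +
  assumes steps: "simple_symmetric_steps M \<xi>"
    and stopping: "stopping_time (natural_filtration M (walk \<xi>)) \<tau>"
    and finite_time: "AE \<omega> in M. \<tau> \<omega> < \<infinity>"
    and law: "distr M (count_space UNIV) (stopped_value (walk \<xi>) \<tau>) = measure_pmf \<mu>"
    and mart: "martingale M (\<lambda>n. natural_filtration M (walk \<xi>) (enat n))
          (\<lambda>n \<omega>. real_of_int (stopped_process (walk \<xi>) \<tau> n \<omega>))"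
    and UI: "uniformly_integrable M (\<lambda>n \<omega>. real_of_int (stopped_process (walk \<xi>) \<tau> n \<omega>))"
begin

abbreviation Z where "Z \<equiv> stopped_value (walk \<xi>) \<tau>"

lemma measurable_Z [measurable]: "Z \<in> measurable M (count_space UNIV)"
  using mart by (intro measurable_stopped_value stopping) (auto simp: martingale_def)

lemma Z_borel [measurable]: "(\<lambda>\<omega>. real_of_int (Z \<omega>)) \<in> borel_measurable M"
  by measurable

lemma tendsto_Z: "AE \<omega> in M.
    (\<lambda>n. real_of_int (stopped_process (walk \<xi>) \<tau> n \<omega>)) \<longlonglongrightarrow> real_of_int (Z \<omega>)"
  using finite_time by eventually_elim (rule stopped_process_tendsto)

lemma integrable_Z: "integrable M (\<lambda>\<omega>. real_of_int (Z \<omega>))"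
  by (rule uniformly_integrable_L1_limit(1)[OF prob_space_axioms UI Z_borel tendsto_Z])

text \<open>Optional stopping in the form used twice below: at time 0 over the whole space, and at
  time 2 over the event of two equal first steps.\<close>

lemma set_integral_Z:
  "A \<in> sets (natural_filtration M (walk \<xi>) (enat m)) \<Longrightarrow>
    (LINT \<omega>:A|M. real_of_int (stopped_process (walk \<xi>) \<tau> m \<omega>)) = (LINT \<omega>:A|M. real_of_int (Z \<omega>))"
  by (rule martingale_set_integral_limit[OF prob_space_axioms mart UI Z_borel tendsto_Z])

lemma walk_0 [simp]: "walk \<xi> 0 \<omega> = 0" and walk_1 [simp]: "walk \<xi> (Suc 0) \<omega> = \<xi> 1 \<omega>"
  and walk_2 [simp]: "walk \<xi> 2 \<omega> = \<xi> 1 \<omega> + \<xi> 2 \<omega>"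
  by (auto simp: walk_def numeral_2_eq_2)

lemma centered: "\<mu> \<in> centered_measures"
proof -
  \<comment> \<open>The stopped walk is \<open>0\<close> at time 0 whatever \<open>\<tau>\<close>
    is, so \<open>Z\<close> has mean zero.\<close>
  have "(LINT \<omega>:space M|M. real_of_int (stopped_process (walk \<xi>) \<tau> 0 \<omega>)) =
      (LINT \<omega>:space M|M. real_of_int (Z \<omega>))"
    by (rule set_integral_Z) (metis sets.top space_natural_filtration)
  moreover have "stopped_process (walk \<xi>) \<tau> 0 \<omega> = 0" for \<omega>
    by (cases "\<tau> \<omega>") (simp_all add: stopped_process_def)
  ultimately have "(LINT \<omega>|M. real_of_int (Z \<omega>)) = 0"
    using integrable_Z by (simp add: set_integral_space)
  then show ?thesis
    unfolding centered_measures_iff_expectation law[symmetric]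
    using integrable_Z by (simp add: integrable_distr_eq integral_distr)
qed

lemma prob_Z: "prob {\<omega> \<in> space M. Z \<omega> \<in> A} = measure_pmf.prob \<mu> A"
  unfolding law[symmetric] by (subst measure_distr) (auto intro!: arg_cong[where f = prob])

lemma measurable_step: "k \<ge> 1 \<Longrightarrow> \<xi> k \<in> measurable M (count_space UNIV)"
  using steps by (auto simp: simple_symmetric_steps_def indep_vars_def)

text \<open>Independence gives this event positive probability, which the contradiction in
  \<open>stopped_by_1\<close> relies on.\<close>

lemma prob_two_steps:
  assumes "s \<in> {-1, 1}"
  shows "prob {\<omega> \<in> space M. \<xi> 1 \<omega> = s \<and> \<xi> 2 \<omega> = s} = 1/4"
proof -
  have iv: "indep_vars (\<lambda>_. count_space UNIV) \<xi> {1..}"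
    and h: "k \<ge> 1 \<Longrightarrow> prob {\<omega> \<in> space M. \<xi> k \<omega> = s} = 1/2" for k
    using steps assms by (auto simp: simple_symmetric_steps_def)
  have v: "\<xi> k -` {s} \<inter> space M = {\<omega> \<in> space M. \<xi> k \<omega> = s}" for k by auto
  have "prob (\<Inter>i\<in>{1,2}. \<xi> i -` {s} \<inter> space M) = (\<Prod>i\<in>{1,2}. prob (\<xi> i -` {s} \<inter> space M))"
    by (rule indep_varsD[OF iv]) auto
  also have "\<dots> = 1/4" by (simp add: v h)
  also have "(\<Inter>i\<in>{1,2}. \<xi> i -` {s} \<inter> space M) = {\<omega> \<in> space M. \<xi> 1 \<omega> = s \<and> \<xi> 2 \<omega> = s}"
    by auto
  finally show ?thesis .
qed

text \<open>The two events of probability 1/2 are disjoint, so no mass is left for other integer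
  values.\<close>

lemma AE_first_step: "AE \<omega> in M. \<xi> 1 \<omega> = 1 \<or> \<xi> 1 \<omega> = -1"
proof -
  have [measurable]: "\<xi> 1 \<in> measurable M (count_space UNIV)"
    by (rule measurable_step) simp
  have m: "{\<omega> \<in> space M. \<xi> 1 \<omega> = s} \<in> events" for s
    by measurable
  have "prob ({\<omega> \<in> space M. \<xi> 1 \<omega> = 1} \<union> {\<omega> \<in> space M. \<xi> 1 \<omega> = -1}) =
      prob {\<omega> \<in> space M. \<xi> 1 \<omega> = 1} + prob {\<omega> \<in> space M. \<xi> 1 \<omega> = -1}"
    by (rule finite_measure_Union[OF m m]) auto
  also have "\<dots> = 1"
    using steps unfolding simple_symmetric_steps_def by force
  finally have "AE \<omega> in M. \<omega> \<in> {\<omega> \<in> space M. \<xi> 1 \<omega> = 1} \<union> {\<omega> \<in> space M. \<xi> 1 \<omega> = -1}"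
    using m by (intro prob_eq_1[THEN iffD1]) auto
  then show ?thesis by eventually_elim auto
qed

text \<open>If the walk were not stopped at time \<open>1\<close> after a step \<open>s\<close>, it would reach \<open>2 * s\<close> at time
  \<open>2\<close> with positive probability, and the martingale could not return to \<open>{-1..1}\<close> in mean.\<close>

lemma stopped_by_1:
  assumes supp: "set_pmf \<mu> \<subseteq> {-1..1}" and s: "s \<in> {-1, 1}"
    and \<omega>: "\<omega> \<in> space M" "\<xi> 1 \<omega> = s"
  shows "\<tau> \<omega> \<le> 1"
proof (rule ccontr)
  assume n: "\<not> \<tau> \<omega> \<le> 1"
  define A where "A = {\<omega> \<in> space M. \<xi> 1 \<omega> = s \<and> \<xi> 2 \<omega> = s}"
  \<comment> \<open>The positions at times 1 and 2 determine both steps, so \<open>A\<close> is an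
    event of time 2.\<close>
  have "A = (walk \<xi> 1 -` {s} \<inter> space M) \<inter> (walk \<xi> 2 -` {2 * s} \<inter> space M)"
    unfolding A_def by auto
  also have "\<dots> \<in> sets (natural_filtration M (walk \<xi>) (enat 2))"
    by (intro sets.Int vimage_in_natural_filtration) auto
  finally have A: "A \<in> sets (natural_filtration M (walk \<xi>) (enat 2))" .
  then have AM[measurable]: "A \<in> sets M"
    using mart by (auto simp: martingale_def subalgebra_def)
  \<comment> \<open>Each path in \<open>A\<close> agrees with \<open>\<omega>\<close> up to time 1,
    hence is not stopped by then either.\<close>
  have Y2: "stopped_process (walk \<xi>) \<tau> 2 \<omega>' = 2 * s" if "\<omega>' \<in> A" for \<omega>'
  proof -
    have "\<not> \<tau> \<omega>' \<le> 1"
    proof -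
      have "walk \<xi> k \<omega> = walk \<xi> k \<omega>'" if "enat k \<le> 1" for k
      proof -
        have "k = 0 \<or> k = Suc 0" using that by (auto simp: one_enat_def)
        then show ?thesis using \<omega> \<open>\<omega>' \<in> A\<close> by (auto simp: A_def)
      qed
      with stopping_time_determined[OF stopping \<omega>(1), of \<omega>' 1] n that show ?thesis
        by (auto simp: A_def)
    qed
    then have "enat 2 \<le> \<tau> \<omega>'"
      by (cases "\<tau> \<omega>'") (auto simp: one_enat_def)
    then show ?thesis using that by (simp add: stopped_process_def min_def A_def)
  qed
  have Z1: "AE \<omega> in M. \<bar>Z \<omega>\<bar> \<le> 1"
  proof -
    have "prob {\<omega> \<in> space M. Z \<omega> \<in> {-1..1}} = 1"
      unfolding prob_Z using supp by (subst measure_pmf.prob_eq_1) (auto simp: AE_measure_pmf_iff)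
    then have "AE \<omega> in M. \<omega> \<in> {\<omega> \<in> space M. Z \<omega> \<in> {-1..1}}"
      by (intro prob_eq_1[THEN iffD1]) auto
    then show ?thesis by eventually_elim auto
  qed
  have ss: "real_of_int s * real_of_int s = 1" using s by auto
  \<comment> \<open>The factor \<open>s\<close>, with \<open>s * s = 1\<close>, treats both signs at
    once. As \<open>s * Z \<omega> \<le> 1\<close> almost surely, the chain gives
    \<open>2 * prob A \<le> prob A\<close>, against \<open>prob A = 1/4\<close>.\<close>
  have "2 * prob A = (LINT \<omega>|M. indicator A \<omega> * 2)"
    by simp
  also have "\<dots> = (LINT \<omega>|M. real_of_int s * (indicator A \<omega> *\<^sub>R real_of_int (stopped_process (walk \<xi>) \<tau> 2 \<omega>)))"
    using Y2 ss by (intro Bochner_Integration.integral_cong) (auto split: split_indicator)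
  also have "\<dots> = real_of_int s * (LINT \<omega>:A|M. real_of_int (stopped_process (walk \<xi>) \<tau> 2 \<omega>))"
    by (simp add: set_lebesgue_integral_def)
  also have "\<dots> = real_of_int s * (LINT \<omega>:A|M. real_of_int (Z \<omega>))"
    using set_integral_Z[OF A] by simp
  also have "\<dots> = (LINT \<omega>|M. real_of_int s * (indicator A \<omega> *\<^sub>R real_of_int (Z \<omega>)))"
    by (simp add: set_lebesgue_integral_def)
  also have "\<dots> \<le> (LINT \<omega>|M. indicator A \<omega>)"
  proof (rule integral_mono_AE)
    show "integrable M (\<lambda>\<omega>. real_of_int s * (indicator A \<omega> *\<^sub>R real_of_int (Z \<omega>)))"
      using integrable_Z AM by (intro integrable_mult_right integrable_mult_indicator)
    show "integrable M (indicator A :: 'a \<Rightarrow> real)"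
      by (simp add: AM less_top[symmetric])
    show "AE \<omega> in M. real_of_int s * (indicator A \<omega> *\<^sub>R real_of_int (Z \<omega>)) \<le> indicator A \<omega>"
      using Z1 by eventually_elim (use s in \<open>auto split: split_indicator\<close>)
  qed
  also have "\<dots> = prob A" by simp
  finally show False
    using prob_two_steps[OF s] by (simp add: A_def)
qed

lemma pmf_0_trivial:
  assumes supp: "set_pmf \<mu> \<subseteq> {-1..1}"
  shows "pmf \<mu> 0 = 0 \<or> pmf \<mu> 0 = 1"
proof (cases "\<exists>\<omega>\<in>space M. \<tau> \<omega> \<le> 0")
  case True
  then obtain \<omega>0 where \<omega>0: "\<omega>0 \<in> space M" "\<tau> \<omega>0 \<le> 0" by blast
  \<comment> \<open>All paths agree at time 0, so one point stopped there forces all of them to be,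
    and \<open>Z\<close> is constantly \<open>0\<close>.\<close>
  have "\<tau> \<omega> \<le> 0" if "\<omega> \<in> space M" for \<omega>
    using stopping_time_determined[OF stopping \<omega>0(1) that, of 0] \<omega>0(2) by (auto simp: zero_enat_def)
  then have "\<tau> \<omega> = enat 0" if "\<omega> \<in> space M" for \<omega>
    using that by (simp add: zero_enat_def[symmetric])
  then have "{\<omega> \<in> space M. Z \<omega> \<in> {0}} = space M"
    by (auto simp: stopped_value_def)
  then show ?thesis using prob_Z[of "{0}"] prob_space by (simp add: pmf.rep_eq)
next
  case False
  \<comment> \<open>No path stops at time 0 and \<open>stopped_by_1\<close> bounds
    \<open>\<tau>\<close> by 1, so almost every path stops exactly at time 1, away from
    \<open>0\<close>.\<close>
  have "AE \<omega> in M. \<not> Z \<omega> = 0"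
    using AE_first_step AE_space
  proof eventually_elim
    fix \<omega> assume 1: "\<xi> 1 \<omega> = 1 \<or> \<xi> 1 \<omega> = -1" and \<omega>: "\<omega> \<in> space M"
    have "\<tau> \<omega> \<le> 1" using stopped_by_1[OF supp _ \<omega>, of "\<xi> 1 \<omega>"] 1 by auto
    moreover have "\<not> \<tau> \<omega> \<le> 0" using False \<omega> by blast
    ultimately have "\<tau> \<omega> = enat 1"
      by (cases "\<tau> \<omega>") (auto simp: one_enat_def zero_enat_def)
    then show "\<not> Z \<omega> = 0" using 1 by (auto simp: stopped_value_def)
  qed
  then have "prob {\<omega> \<in> space M. Z \<omega> \<in> {0}} = 0"
    by (intro prob_eq_0[THEN iffD2]) auto
  then show ?thesis unfolding prob_Z by (simp add: pmf.rep_eq)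
qed

end

section \<open>The strict inclusion\<close>

lemma UI_embeddable_measuresE:
  assumes "simple_symmetric_steps M \<xi>" "\<mu> \<in> UI_embeddable_measures M (walk \<xi>)"
  obtains \<tau> where "embedded_walk M \<xi> \<tau> \<mu>"
proof -
  have "prob_space M" using assms(1) by (simp add: simple_symmetric_steps_def)
  moreover obtain \<tau> where "stopping_time (natural_filtration M (walk \<xi>)) \<tau>"
    "AE \<omega> in M. \<tau> \<omega> < \<infinity>"
    "distr M (count_space UNIV) (stopped_value (walk \<xi>) \<tau>) = measure_pmf \<mu>"
    "martingale M (\<lambda>n. natural_filtration M (walk \<xi>) (enat n))
      (\<lambda>n \<omega>. real_of_int (stopped_process (walk \<xi>) \<tau> n \<omega>))"
    "uniformly_integrable M (\<lambda>n \<omega>. real_of_int (stopped_process (walk \<xi>) \<tau> n \<omega>))"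
    using assms(2) unfolding UI_embeddable_measures_def by (elim CollectE exE conjE)
  ultimately show thesis
    using assms(1) by (intro that[of \<tau>] embedded_walk.intro embedded_walk_axioms.intro)
qed

theorem proposition1:
  fixes M :: "'a measure" and \<xi> :: "nat \<Rightarrow> 'a \<Rightarrow> int"
  assumes "simple_symmetric_steps M \<xi>"
  shows "UI_embeddable_measures M (walk \<xi>) \<subset> centered_measures"
proof
  show "UI_embeddable_measures M (walk \<xi>) \<subseteq> centered_measures"
  proof
    fix \<mu> assume "\<mu> \<in> UI_embeddable_measures M (walk \<xi>)"
    then obtain \<tau> where "embedded_walk M \<xi> \<tau> \<mu>"
      by (rule UI_embeddable_measuresE[OF assms])
    then show "\<mu> \<in> centered_measures"
      by (rule embedded_walk.centered)
  qed
  \<comment> \<open>Centred by symmetry and supported in \<open>{-1..1}\<close>, but with mass 1/3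
    at \<open>0\<close>, which \<open>pmf_0_trivial\<close> forbids for an embedded law.\<close>
  define \<mu> :: "int pmf" where "\<mu> = pmf_of_set {-1, 0, 1}"
  have "integrable (measure_pmf \<mu>) real_of_int"
    by (rule integrable_measure_pmf_finite) (simp add: \<mu>_def)
  then have "\<mu> \<in> centered_measures"
    by (simp add: centered_measures_iff_expectation \<mu>_def integral_pmf_of_set)
  moreover have "\<mu> \<notin> UI_embeddable_measures M (walk \<xi>)"
  proof
    assume "\<mu> \<in> UI_embeddable_measures M (walk \<xi>)"
    then obtain \<tau> where "embedded_walk M \<xi> \<tau> \<mu>"
      by (rule UI_embeddable_measuresE[OF assms])
    then have "pmf \<mu> 0 = 0 \<or> pmf \<mu> 0 = 1"
      by (rule embedded_walk.pmf_0_trivial) (auto simp: \<mu>_def)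
    then show False by (simp add: \<mu>_def)
  qed
  ultimately show "UI_embeddable_measures M (walk \<xi>) \<noteq> centered_measures" by blast
qed

end
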